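(* For any fixed $c>0$ there exists a function $g_c(\epsilon,d)$ such that $$IC^{\to}_{\epsilon}(GH_c)\ge(1-g_c(\epsilon,d))\cdot d,$$ and $g_c(\epsilon_i,d_i)\to0$ for every sequence of pairs $\{(\epsilon_i,d_i)\}_{i\ge1}$ with $\epsilon_i\to0$ and $d_i\to\infty$.
   Context: One-way Gap-Hamming problem $GH_c$: Alice gets $x\in\{0,1\}^d$ and Bob gets $y\in\{0,1\}^d$, independent and uniform. The partial function is $GH_c(x,y)=1$ if $d_H(x,y)\le d/2-c\sqrt d$, $GH_c(x,y)=0$ if $d_H(x,y)\ge d/2+c\sqrt d$, and undefined otherwise. In a one-way protocol Alice sends a single (possibly randomized) message $M$ depending on $x$, and Bob outputs a bit depending on $M$ and $y$; the protocol errs if $GH_c(x,y)$ is defined and Bob's output differs from it. $IC^{\to}_\epsilon(GH_c)$ is the infimum of $I(X;M)$ (in bits, under uniform independent inputs) over all one-way protocols whose error probability is at most $\epsilon$. *)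

theory Defs
  imports "HOL-Probability.Probability"
begin

definition cube :: "nat \<Rightarrow> bool list set" where
  "cube d = {xs. length xs = d}"

definition hamming :: "bool list \<Rightarrow> bool list \<Rightarrow> nat" where
  "hamming xs ys = card {i. i < length xs \<and> xs ! i \<noteq> ys ! i}"

definition GH :: "real \<Rightarrow> nat \<Rightarrow> bool list \<Rightarrow> bool list \<Rightarrow> bool option" where
  "GH c d x y =
     (if real (hamming x y) \<le> real d / 2 - c * sqrt (real d) then Some True
      else if real (hamming x y) \<ge> real d / 2 + c * sqrt (real d) then Some False
      else None)"

text \<open>A one-way protocol: Alice's randomized message \<open>mu x\<close> (a distribution on
  messages, w.l.o.g. encoded as natural numbers since a pmf has countable support),
  and Bob's deterministic output \<open>bob m y\<close>.\<close>

definition gh_error :: "real \<Rightarrow> nat \<Rightarrow> (bool list \<Rightarrow> nat pmf) \<Rightarrow> (nat \<Rightarrow> bool list \<Rightarrow> bool) \<Rightarrow> real" where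
  "gh_error c d mu bob =
     (\<Sum>x\<in>cube d. \<Sum>y\<in>cube d.
        measure_pmf.prob (mu x) {m. GH c d x y \<noteq> None \<and> GH c d x y \<noteq> Some (bob m y)})
     / 2 ^ (2 * d)"

definition msg_marginal :: "nat \<Rightarrow> (bool list \<Rightarrow> nat pmf) \<Rightarrow> nat \<Rightarrow> real" where
  "msg_marginal d mu m = (\<Sum>x\<in>cube d. pmf (mu x) m) / 2 ^ d"

definition mutual_info :: "nat \<Rightarrow> (bool list \<Rightarrow> nat pmf) \<Rightarrow> real" where
  "mutual_info d mu =
     (\<Sum>\<^sub>\<infinity>m. \<Sum>x\<in>cube d. (pmf (mu x) m / 2 ^ d) *
                 log 2 (pmf (mu x) m / msg_marginal d mu m))"

text \<open>One-way information complexity: infimum (in the extended reals, Inf of the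
  empty set being +\<infinity>) of I(X;M) over protocols with error at most eps.\<close>
definition IC_oneway :: "real \<Rightarrow> real \<Rightarrow> nat \<Rightarrow> ereal" where
  "IC_oneway c eps d =
     (INF P \<in> {(mu, bob). gh_error c d mu bob \<le> eps}. ereal (mutual_info d (fst P)))"

end

theory Submission
  imports Defs
begin

text \<open>
  If \<open>x\<close> and \<open>x'\<close> differ in at least \<open>\<gamma> d\<close> coordinates, then for a constant fraction
  \<open>p = p(\<gamma>, c)\<close> of all \<open>y\<close> the values at \<open>(x, y)\<close> and \<open>(x', y)\<close> are defined and differ, so
  any fixed answer row of Bob has total error at least \<open>p\<close> on the two inputs. Given a message,
  let \<open>x0\<close> be the input on which the corresponding row errs least; every input far from \<open>x0\<close>
  then has error at least \<open>p / 2\<close>, so Alice's input lies within \<open>\<gamma> d\<close> of \<open>x0\<close> except with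
  probability \<open>2 \<epsilon> / p\<close>. Comparing the posterior with independent bit flips of \<open>x0\<close> at a
  small rate \<open>\<theta>\<close> (Gibbs' inequality) gives
  \<open>I(X;M) \<ge> d (1 + log (1 - \<theta>) + (\<gamma> + 2 \<epsilon> / p) log \<theta>)\<close>; choose \<open>\<theta>\<close>, then \<open>\<gamma>\<close>, then \<open>\<epsilon>\<close>.
\<close>

section \<open>The Boolean cube, and Hamming distance as a sum over coordinates\<close>

lemma cube_Suc: "cube (Suc d) = (#) True ` cube d \<union> (#) False ` cube d"
proof (intro equalityI subsetI)
  fix xs assume "xs \<in> cube (Suc d)"
  then obtain b ys where "xs = b # ys" "length ys = d"
    by (auto simp: cube_def length_Suc_conv)
  then show "xs \<in> (#) True ` cube d \<union> (#) False ` cube d"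
    by (cases b) (auto simp: cube_def)
qed (auto simp: cube_def)

lemma cube_0: "cube 0 = {[]}"
  by (auto simp: cube_def)

lemma finite_cube [simp]: "finite (cube d)"
  by (induction d) (auto simp: cube_0 cube_Suc)

lemma sum_cube_Suc:
  fixes h :: "bool list \<Rightarrow> real"
  shows "(\<Sum>y\<in>cube (Suc d). h y) = (\<Sum>y\<in>cube d. h (True # y) + h (False # y))"
proof -
  have "(\<Sum>y\<in>cube (Suc d). h y) = sum h ((#) True ` cube d) + sum h ((#) False ` cube d)"
    unfolding cube_Suc by (rule sum.union_disjoint) auto
  then show ?thesis
    by (simp add: sum.reindex sum.distrib)
qed

lemma cube_nonempty: "cube d \<noteq> {}"
  by (auto simp: cube_def intro: exI[of _ "replicate d True"])

lemma card_cube: "card (cube d) = 2 ^ d"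
  using card_lists_length_eq[of "UNIV :: bool set" d] by (simp add: cube_def)

lemma hamming_eq_sum:
  assumes "length x = d"
  shows "real (hamming x y) = (\<Sum>i<d. if x ! i \<noteq> y ! i then 1 else 0)"
proof -
  have "(\<Sum>i<d. if x ! i \<noteq> y ! i then 1 else 0) = real (card ({..<d} \<inter> {i. x ! i \<noteq> y ! i}))"
    by (simp add: sum.If_cases)
  also have "{..<d} \<inter> {i. x ! i \<noteq> y ! i} = {i. i < length x \<and> x ! i \<noteq> y ! i}"
    using assms by auto
  finally show ?thesis by (simp add: hamming_def)
qed

lemma hamming_le: "length x = d \<Longrightarrow> hamming x y \<le> d"
  unfolding hamming_def using card_mono[of "{..<d}" "{i. i < length x \<and> x ! i \<noteq> y ! i}"] by auto

subsection \<open>Moments of product measures on the cube\<close>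

text \<open>Splitting off coordinate 0 leaves the factor \<open>f 0 True + f 0 False\<close>, which
  is 1. Used for the biased law of \<open>y\<close> and again for the noisy guess of the
  input.\<close>

lemma sum_product_weight:
  fixes f :: "nat \<Rightarrow> bool \<Rightarrow> real"
  assumes "\<And>i. f i True + f i False = 1"
  shows "(\<Sum>y\<in>cube d. \<Prod>i<d. f i (y ! i)) = 1"
  using assms
proof (induction d arbitrary: f)
  case 0
  then show ?case by (simp add: cube_0)
next
  case (Suc d)
  have "(\<Sum>y\<in>cube (Suc d). \<Prod>i<Suc d. f i (y ! i))
      = (\<Sum>y\<in>cube d. (f 0 True + f 0 False) * (\<Prod>i<d. f (Suc i) (y ! i)))"
    by (simp add: sum_cube_Suc prod.lessThan_Suc_shift algebra_simps del: prod.lessThan_Suc)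
  then show ?case
    using Suc.IH[of "\<lambda>i. f (Suc i)"] Suc.prems by simp
qed

text \<open>Variances of independent centred coordinates add: when the square is expanded, the cross
  term carries a factor that \<open>mean\<close> makes zero.\<close>

lemma sum_product_weight_variance:
  fixes f g :: "nat \<Rightarrow> bool \<Rightarrow> real"
  assumes tot: "\<And>i. f i True + f i False = 1"
    and mean: "\<And>i. f i True * g i True + f i False * g i False = 0"
  shows "(\<Sum>y\<in>cube d. (\<Prod>i<d. f i (y ! i)) * (\<Sum>i<d. g i (y ! i))\<^sup>2)
       = (\<Sum>i<d. f i True * (g i True)\<^sup>2 + f i False * (g i False)\<^sup>2)"
  using assms
proof (induction d arbitrary: f g)
  case 0
  then show ?case by (simp add: cube_0)
next
  case (Suc d)
  let ?w = "\<lambda>y. \<Prod>i<d. f (Suc i) (y ! i)" and ?s = "\<lambda>y. \<Sum>i<d. g (Suc i) (y ! i)"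
  let ?v = "\<lambda>i. f i True * (g i True)\<^sup>2 + f i False * (g i False)\<^sup>2"
  have "(\<Sum>y\<in>cube (Suc d). (\<Prod>i<Suc d. f i (y ! i)) * (\<Sum>i<Suc d. g i (y ! i))\<^sup>2)
      = (\<Sum>y\<in>cube d. ?v 0 * ?w y
            + 2 * (f 0 True * g 0 True + f 0 False * g 0 False) * (?w y * ?s y)
            + (f 0 True + f 0 False) * (?w y * (?s y)\<^sup>2))"
    by (simp add: sum_cube_Suc prod.lessThan_Suc_shift sum.lessThan_Suc_shift
        power2_eq_square algebra_simps del: prod.lessThan_Suc sum.lessThan_Suc)
  also have "\<dots> = (\<Sum>y\<in>cube d. ?v 0 * ?w y + ?w y * (?s y)\<^sup>2)"
    using Suc.prems by simp
  also have "\<dots> = ?v 0 * (\<Sum>y\<in>cube d. ?w y) + (\<Sum>y\<in>cube d. ?w y * (?s y)\<^sup>2)"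
    by (simp only: sum.distrib sum_distrib_left)
  also have "\<dots> = ?v 0 + (\<Sum>i<d. ?v (Suc i))"
    using Suc.IH[of "\<lambda>i. f (Suc i)" "\<lambda>i. g (Suc i)"]
      sum_product_weight[of "\<lambda>i. f (Suc i)"] Suc.prems by simp
  finally show ?case
    by (simp only: sum.lessThan_Suc_shift)
qed

subsection \<open>Separating two distant points\<close>

text \<open>The factor \<open>exp (- (t * (t + 2)))\<close> is a change of measure: bias \<open>y\<close> towards \<open>x\<close> by
  \<open>t / sqrt d\<close> on the coordinates where \<open>x\<close> and \<open>x'\<close> differ. Chebyshev's inequality makes the
  separation likely under the biased law, whose density on the Chebyshev event is at most
  \<open>exp (t * (t + 2))\<close>.\<close>

lemma card_separating_ge:
  fixes c \<gamma> t :: real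
  assumes c: "c > 0" and \<gamma>: "\<gamma> > 0" and t: "t = (2 * c + 4) / \<gamma>"
    and d: "real d \<ge> t\<^sup>2" and x: "x \<in> cube d" and x': "x' \<in> cube d"
    and far: "real (hamming x x') \<ge> \<gamma> * real d"
  shows "real (card {y \<in> cube d. GH c d x y = Some True \<and> GH c d x' y = Some False})
      \<ge> 3 / 4 * exp (- (t * (t + 2))) * 2 ^ d"
proof -
  have tpos: "t > 0" using c \<gamma> t by simp
  have dpos: "real d > 0" using d tpos by (smt (verit) zero_less_power)
  define r where "r = sqrt (real d)"
  have rpos: "r > 0" and rr: "r * r = real d" using dpos by (auto simp: r_def)
  have tr: "t \<le> r" using d tpos unfolding r_def by (simp add: real_le_rsqrt)
  \<comment> \<open>\<open>\<sigma>\<close> is the sign of agreement with \<open>x\<close>, and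
    \<open>S\<close> marks where \<open>x\<close> and \<open>x'\<close> differ. Under the law
    \<open>f\<close> the sign has mean \<open>\<tau>\<close>, so \<open>g\<close> is the centred
    agreement on the differing coordinates and \<open>h\<close> the unbiased agreement on the
    others.\<close>
  define \<sigma> :: "nat \<Rightarrow> bool \<Rightarrow> real" where "\<sigma> i b = (if b = x ! i then 1 else -1)" for i b
  define S :: "nat \<Rightarrow> real" where "S i = (if x ! i \<noteq> x' ! i then 1 else 0)" for i
  define \<tau> where "\<tau> i = t / r * S i" for i
  define f where "f i b = (1 + \<tau> i * \<sigma> i b) / 2" for i b
  define g where "g i b = S i * (\<sigma> i b - \<tau> i)" for i b
  define h where "h i b = (1 - S i) * \<sigma> i b" for i b
  define U where "U y = (\<Sum>i<d. S i * \<sigma> i (y ! i))" for y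
  define V where "V y = (\<Sum>i<d. h i (y ! i))" for y
  define w where "w y = (\<Prod>i<d. f i (y ! i))" for y
  define Z where "Z y = (\<Sum>i<d. g i (y ! i))\<^sup>2 + (V y)\<^sup>2" for y
  define D where "D = (\<Sum>i<d. S i)"
  have lx: "length x = d" "length x' = d" using x x' by (auto simp: cube_def)
  have DH: "D = real (hamming x x')"
    unfolding D_def S_def hamming_eq_sum[OF lx(1)] by simp
  have D1: "D \<ge> \<gamma> * real d" using far DH by simp
  have D2: "D \<le> real d" using DH hamming_le[OF lx(1)] by simp
  have \<tau>01: "0 \<le> \<tau> i" "\<tau> i \<le> 1" for i
    using tpos rpos tr by (auto simp: \<tau>_def S_def)
  have \<tau>h: "(1 - S i) * \<tau> i = 0" for i by (simp add: \<tau>_def S_def)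
  have \<sigma>TF: "(\<sigma> i True = 1 \<and> \<sigma> i False = -1) \<or> (\<sigma> i True = -1 \<and> \<sigma> i False = 1)" for i
    by (simp add: \<sigma>_def)
  have f0: "f i b \<ge> 0" for i b
    using \<tau>01[of i] by (auto simp: f_def \<sigma>_def)
  have w0: "w y \<ge> 0" for y unfolding w_def by (intro prod_nonneg) (auto simp: f0)
  have ft: "f i True + f i False = 1" for i
    using \<sigma>TF[of i] by (auto simp: f_def field_simps)
  have fg: "f i True * g i True + f i False * g i False = 0" for i
    using \<sigma>TF[of i] by (auto simp: f_def g_def field_simps)
  have fh: "f i True * h i True + f i False * h i False = 0" for i
    using \<sigma>TF[of i] \<tau>h[of i] by (auto simp: f_def h_def field_simps)
  \<comment> \<open>At each coordinate at most one of \<open>g\<close> and \<open>h\<close> is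
    nonzero, so both variances together cost at most 1.\<close>
  have var1: "(f i True * (g i True)\<^sup>2 + f i False * (g i False)\<^sup>2)
      + (f i True * (h i True)\<^sup>2 + f i False * (h i False)\<^sup>2) \<le> 1" for i
  proof (cases "x ! i = x' ! i")
    case True
    then have "S i = 0" by (simp add: S_def)
    then show ?thesis using \<sigma>TF[of i] ft[of i] by (auto simp: g_def h_def)
  next
    case False
    then have S: "S i = 1" by (simp add: S_def)
    have "f i True * (g i True)\<^sup>2 + f i False * (g i False)\<^sup>2 = 1 - (\<tau> i)\<^sup>2"
      using \<sigma>TF[of i] S by (auto simp: f_def g_def field_simps power2_eq_square)
    then show ?thesis using S by (simp add: h_def)
  qed
  have EZ: "(\<Sum>y\<in>cube d. w y * Z y) \<le> real d"
  proof -
    have "(\<Sum>y\<in>cube d. w y * Z y) = (\<Sum>y\<in>cube d. w y * (\<Sum>i<d. g i (y ! i))\<^sup>2)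
        + (\<Sum>y\<in>cube d. w y * (\<Sum>i<d. h i (y ! i))\<^sup>2)"
      by (simp add: Z_def V_def distrib_left sum.distrib)
    also have "\<dots> = (\<Sum>i<d. (f i True * (g i True)\<^sup>2 + f i False * (g i False)\<^sup>2)
      + (f i True * (h i True)\<^sup>2 + f i False * (h i False)\<^sup>2))"
      unfolding w_def sum_product_weight_variance[of f g, OF ft fg]
        sum_product_weight_variance[of f h, OF ft fh] by (simp add: sum.distrib)
    also have "\<dots> \<le> (\<Sum>i<d. 1)" by (intro sum_mono var1)
    finally show ?thesis by simp
  qed
  define G where "G = {y \<in> cube d. Z y \<le> 4 * real d}"
  have fG: "finite G" by (simp add: G_def)
  have "1 = (\<Sum>y\<in>cube d. w y)" using sum_product_weight[of f, OF ft] by (simp add: w_def)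
  \<comment> \<open>Markov's inequality: off \<open>G\<close> the ratio
    \<open>Z y / (4 * real d)\<close> exceeds 1, while its mean is at most 1/4.\<close>
  also have "\<dots> \<le> (\<Sum>y\<in>cube d. (if y \<in> G then w y else 0) + w y * Z y / (4 * real d))"
  proof (intro sum_mono)
    fix y assume y: "y \<in> cube d"
    have Z0: "Z y \<ge> 0" by (simp add: Z_def)
    show "w y \<le> (if y \<in> G then w y else 0) + w y * Z y / (4 * real d)"
    proof (cases "y \<in> G")
      case True
      then show ?thesis using Z0 w0[of y] by simp
    next
      case False
      then have "1 \<le> Z y / (4 * real d)" using y dpos by (simp add: G_def)
      then have "w y * 1 \<le> w y * (Z y / (4 * real d))" using w0 by (intro mult_left_mono)
      then show ?thesis using False by simp
    qed
  qed
  also have "\<dots> = (\<Sum>y\<in>G. w y) + (\<Sum>y\<in>cube d. w y * Z y) / (4 * real d)"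
  proof -
    have "cube d \<inter> G = G" by (auto simp: G_def)
    then show ?thesis by (simp add: sum.distrib sum_divide_distrib sum.If_cases)
  qed
  also have "\<dots> \<le> (\<Sum>y\<in>G. w y) + 1 / 4"
    using EZ dpos by (simp add: field_simps)
  finally have wG: "(\<Sum>y\<in>G. w y) \<ge> 3 / 4" by simp
  have G_bounds: "\<bar>U y - t / r * D\<bar> \<le> 2 * r \<and> \<bar>V y\<bar> \<le> 2 * r" if "y \<in> G" for y
  proof -
    have "(\<Sum>i<d. g i (y ! i)) = (\<Sum>i<d. S i * \<sigma> i (y ! i) - t / r * S i)"
      by (intro sum.cong) (auto simp: g_def \<tau>_def S_def)
    then have UZ: "(\<Sum>i<d. g i (y ! i)) = U y - t / r * D"
      by (simp add: U_def D_def sum_subtractf sum_distrib_left)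
    have "(U y - t / r * D)\<^sup>2 + (V y)\<^sup>2 \<le> (2 * r)\<^sup>2"
      proof -
      have "Z y \<le> 4 * (r * r)" using that rr by (simp add: G_def)
      then show ?thesis unfolding Z_def UZ by (simp add: power_mult_distrib power2_eq_square[of r])
    qed
    then have "(U y - t / r * D)\<^sup>2 \<le> (2 * r)\<^sup>2" "(V y)\<^sup>2 \<le> (2 * r)\<^sup>2"
      using zero_le_power2[of "V y"] zero_le_power2[of "U y - t / r * D"] by linarith+
    then show ?thesis using rpos by (auto simp only: abs_le_square_iff[symmetric] abs_mult abs_of_pos abs_numeral)
  qed
  have w_le: "w y \<le> exp (t * (t + 2)) / 2 ^ d" if "y \<in> G" for y
  proof -
    \<comment> \<open>By \<open>1 + u \<le> exp u\<close> the weight is bounded through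
      \<open>U y\<close> alone, which is bounded above on \<open>G\<close>.\<close>
    have "w y \<le> (\<Prod>i<d. exp (\<tau> i * \<sigma> i (y ! i)) / 2)"
      unfolding w_def
    proof (intro prod_mono conjI f0)
      fix i
      show "f i (y ! i) \<le> exp (\<tau> i * \<sigma> i (y ! i)) / 2"
        unfolding f_def by (intro divide_right_mono exp_ge_add_one_self) simp
    qed
    also have "\<dots> = exp (\<Sum>i<d. \<tau> i * \<sigma> i (y ! i)) / 2 ^ d"
      by (simp add: prod_dividef exp_sum)
    also have "(\<Sum>i<d. \<tau> i * \<sigma> i (y ! i)) = t / r * U y"
      by (simp add: \<tau>_def U_def sum_distrib_left mult.assoc)
    also have "t / r * U y \<le> t / r * ((t + 2) * r)"
    proof (intro mult_left_mono)
      have "t / r * D \<le> t / r * (r * r)"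
        using D2 rr tpos rpos by (intro mult_left_mono) auto
      then have "t / r * D \<le> t * r" using rpos by simp
      then show "U y \<le> (t + 2) * r" using G_bounds[OF that] by (auto simp: algebra_simps)
    qed (use tpos rpos in auto)
    also have "t / r * ((t + 2) * r) = t * (t + 2)" using rpos by simp
    finally show ?thesis by (simp add: divide_right_mono)
  qed
  have sub: "G \<subseteq> {y \<in> cube d. GH c d x y = Some True \<and> GH c d x' y = Some False}"
  proof
    fix y assume y: "y \<in> G"
    \<comment> \<open>A disagreement with \<open>x\<close> is \<open>(1 - \<sigma>) / 2\<close>, and
      \<open>\<sigma>\<close> splits as \<open>S * \<sigma> + h\<close>. Passing to
      \<open>x'\<close> flips the sign exactly where \<open>S\<close> is 1, hence the opposite sign
      of \<open>U\<close> in \<open>H2\<close>.\<close>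
    have "(\<Sum>i<d. if x ! i \<noteq> y ! i then 1 else (0::real))
        = (\<Sum>i<d. (1 - S i * \<sigma> i (y ! i) - h i (y ! i)) / 2)"
      by (intro sum.cong) (auto simp: h_def S_def \<sigma>_def)
    then have H1: "real (hamming x y) = (real d - U y - V y) / 2"
      unfolding hamming_eq_sum[OF lx(1)] U_def V_def
      by (simp add: sum_subtractf flip: sum_divide_distrib)
    have "(\<Sum>i<d. if x' ! i \<noteq> y ! i then 1 else (0::real))
        = (\<Sum>i<d. (1 + S i * \<sigma> i (y ! i) - h i (y ! i)) / 2)"
      by (intro sum.cong) (auto simp: h_def S_def \<sigma>_def)
    then have H2: "real (hamming x' y) = (real d + U y - V y) / 2"
      unfolding hamming_eq_sum[OF lx(2)] U_def V_def
      by (simp add: sum_subtractf sum.distrib flip: sum_divide_distrib)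
    \<comment> \<open>This explains the value of \<open>t\<close>: the shift of \<open>U\<close> is
      at least \<open>(2 * c + 4) * r\<close>, the deviations of \<open>U\<close> and
      \<open>V\<close> consume \<open>2 * r\<close> each, and halving the rest leaves the gap
      \<open>c * r\<close>.\<close>
    have "t / r * (\<gamma> * (r * r)) \<le> t / r * D"
      using D1 rr tpos rpos by (intro mult_left_mono) auto
    moreover have "t / r * (\<gamma> * (r * r)) = (2 * c + 4) * r"
      using rpos \<gamma> t by simp
    moreover have cr: "c * r > 0" using c rpos by simp
    ultimately have UV: "U y \<ge> 2 * (c * r) + 2 * r" "V y \<le> 2 * r" "- V y \<le> 2 * r"
      using G_bounds[OF y] by (auto simp: algebra_simps)
    have "real (hamming x y) \<le> real d / 2 - c * r"
      unfolding H1 using UV by argo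
    moreover have "real (hamming x' y) \<ge> real d / 2 + c * r"
      unfolding H2 using UV by argo
    \<comment> \<open>Since \<open>c * r > 0\<close>, the thresholds exclude each other, so
      \<open>x'\<close> fails the first test of \<open>GH\<close>.\<close>
    ultimately show "y \<in> {y \<in> cube d. GH c d x y = Some True \<and> GH c d x' y = Some False}"
      using y cr by (auto simp: GH_def G_def simp flip: r_def)
  qed
  have "3 / 4 \<le> (\<Sum>y\<in>G. exp (t * (t + 2)) / 2 ^ d)"
    using wG by (rule order_trans) (intro sum_mono w_le)
  then have "3 / 4 * 2 ^ d \<le> real (card G) * exp (t * (t + 2))"
    by (simp add: pos_le_divide_eq)
  then have "exp (- (t * (t + 2))) * (3 / 4 * 2 ^ d)
      \<le> exp (- (t * (t + 2))) * (real (card G) * exp (t * (t + 2)))"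
    by (rule mult_left_mono) simp
  also have "\<dots> = exp (- (t * (t + 2)) + t * (t + 2)) * real (card G)"
    by (simp only: exp_add mult_ac)
  finally have "3 / 4 * exp (- (t * (t + 2))) * 2 ^ d \<le> real (card G)"
    by (simp add: mult_ac)
  also have "\<dots> \<le> real (card {y \<in> cube d. GH c d x y = Some True \<and> GH c d x' y = Some False})"
    using sub by (intro of_nat_mono card_mono) auto
  finally show ?thesis .
qed

subsection \<open>Mutual information\<close>

lemma has_sum_sum:
  fixes f :: "'a \<Rightarrow> 'b \<Rightarrow> 'c :: topological_comm_monoid_add"
  assumes "\<And>i. i \<in> I \<Longrightarrow> (f i has_sum s i) A"
  shows "((\<lambda>x. \<Sum>i\<in>I. f i x) has_sum (\<Sum>i\<in>I. s i)) A"
  using assms by (induction I rule: infinite_finite_induct) (auto intro: has_sum_add)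

lemma has_sum_pmf: "(pmf p has_sum measure_pmf.prob p A) A"
proof -
  have "pmf p summable_on A" "infsetsum (pmf p) A = infsum (pmf p) A"
    using pmf_abs_summable[of p A] abs_summable_equivalent abs_summable_summable infsetsum_infsum
    by blast+
  then show ?thesis
    by (metis has_sum_infsum measure_pmf_conv_infsetsum)
qed

lemma has_sum_msg_marginal: "(msg_marginal d mu has_sum 1) UNIV"
proof -
  have "((\<lambda>m. \<Sum>x\<in>cube d. pmf (mu x) m) has_sum (\<Sum>x\<in>cube d. 1)) UNIV"
    using has_sum_pmf[of "mu _" UNIV] by (intro has_sum_sum) auto
  then have "((\<lambda>m. inverse (2 ^ d) * (\<Sum>x\<in>cube d. pmf (mu x) m)) has_sum
      inverse (2 ^ d) * (\<Sum>x\<in>cube d. 1)) UNIV"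
    by (rule has_sum_cmult_right)
  then show ?thesis
    by (simp add: card_cube msg_marginal_def[abs_def] divide_inverse mult.commute)
qed

lemma msg_marginal_nonneg: "msg_marginal d mu m \<ge> 0"
  by (simp add: msg_marginal_def sum_nonneg)

lemma pmf_le_msg_marginal:
  assumes "x \<in> cube d"
  shows "pmf (mu x) m \<le> 2 ^ d * msg_marginal d mu m"
  unfolding msg_marginal_def using member_le_sum[of x "cube d" "\<lambda>x. pmf (mu x) m"] assms by simp

abbreviation msg_info :: "nat \<Rightarrow> (bool list \<Rightarrow> nat pmf) \<Rightarrow> nat \<Rightarrow> real" where
  "msg_info d mu m \<equiv>
     (\<Sum>x\<in>cube d. (pmf (mu x) m / 2 ^ d) * log 2 (pmf (mu x) m / msg_marginal d mu m))"

text \<open>Gibbs' inequality for one message: \<open>w\<close> is a guess for the posterior of the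
  input, and the bound is \<open>ln z \<le> z - 1\<close> with \<open>z\<close> the ratio of guess
  to posterior.\<close>

lemma msg_info_ge_guess:
  assumes w: "\<And>x. x \<in> cube d \<Longrightarrow> w x > 0" and w1: "(\<Sum>x\<in>cube d. w x) \<le> 1"
  shows "(\<Sum>x\<in>cube d. (pmf (mu x) m / 2 ^ d) * log 2 (2 ^ d * w x)) \<le> msg_info d mu m"
proof -
  let ?q = "msg_marginal d mu m"
  have *: "(pmf (mu x) m / 2 ^ d - w x * ?q) / ln 2
      \<le> (pmf (mu x) m / 2 ^ d) * log 2 (pmf (mu x) m / ?q)
        - (pmf (mu x) m / 2 ^ d) * log 2 (2 ^ d * w x)" if x: "x \<in> cube d" for x
  proof (cases "pmf (mu x) m = 0")
    case True
    then show ?thesis using w[OF x] msg_marginal_nonneg[of d mu m] by (simp add: field_simps)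
  next
    case False
    define p where "p = pmf (mu x) m"
    have p: "p > 0" using False by (simp add: p_def pmf_pos)
    have "2 ^ d * ?q > 0" using pmf_le_msg_marginal[OF x, of mu m] p by (simp add: p_def)
    then have q: "?q > 0" by (simp add: zero_less_mult_iff)
    define z where "z = 2 ^ d * w x * ?q / p"
    have z: "z > 0" using p q w[OF x] by (simp add: z_def)
    have "ln z \<le> z - 1" using z by (rule ln_le_minus_one)
    then have "(p / 2 ^ d) * (1 - z) / ln 2 \<le> (p / 2 ^ d) * (- ln z) / ln 2"
      using p by (intro divide_right_mono mult_left_mono) auto
    also have "- ln z = ln (p / ?q) - ln (2 ^ d * w x)"
      using p q w[OF x] by (simp add: z_def ln_mult ln_div)
    also have "(p / 2 ^ d) * (1 - z) = p / 2 ^ d - w x * ?q"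
      using p by (simp add: z_def field_simps)
    finally show ?thesis by (simp add: p_def log_def field_simps)
  qed
  have "0 \<le> (?q - (\<Sum>x\<in>cube d. w x) * ?q) / ln 2"
    using w1 msg_marginal_nonneg[of d mu m] by (simp add: mult_left_le_one_le sum_nonneg w less_imp_le)
  also have "\<dots> = (\<Sum>x\<in>cube d. (pmf (mu x) m / 2 ^ d - w x * ?q) / ln 2)"
    by (simp add: msg_marginal_def sum_subtractf flip: sum_divide_distrib sum_distrib_right)
  also have "\<dots> \<le> (\<Sum>x\<in>cube d. (pmf (mu x) m / 2 ^ d) * log 2 (pmf (mu x) m / ?q)
        - (pmf (mu x) m / 2 ^ d) * log 2 (2 ^ d * w x))"
    by (intro sum_mono *)
  finally show ?thesis by (simp add: sum_subtractf)
qed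

text \<open>The uniform guess makes every logarithm on the left of \<open>msg_info_ge_guess\<close>
  vanish.\<close>

lemma msg_info_nonneg: "msg_info d mu m \<ge> 0"
  using msg_info_ge_guess[of d "\<lambda>_. 1 / 2 ^ d" mu m] by (simp add: card_cube)

text \<open>The posterior is at most 1, so each logarithm is at most \<open>d\<close>. This supplies
  a summable majorant over the messages.\<close>

lemma msg_info_le: "msg_info d mu m \<le> real d * msg_marginal d mu m"
proof -
  let ?q = "msg_marginal d mu m"
  have "(pmf (mu x) m / 2 ^ d) * log 2 (pmf (mu x) m / ?q) \<le> (pmf (mu x) m / 2 ^ d) * real d"
    if x: "x \<in> cube d" for x
  proof (cases "pmf (mu x) m = 0")
    case False
    then have p: "pmf (mu x) m > 0" by (simp add: pmf_pos)
    have le: "pmf (mu x) m \<le> 2 ^ d * ?q" using pmf_le_msg_marginal[OF x] .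
    then have "2 ^ d * ?q > 0" using p by linarith
    then have q: "?q > 0" by (simp add: zero_less_mult_iff)
    have "log 2 (pmf (mu x) m / ?q) \<le> log 2 (2 ^ d)"
      using p q le by (subst log_le_cancel_iff) (auto simp: field_simps)
    then show ?thesis by (intro mult_left_mono) (auto simp: log_nat_power)
  qed simp
  then have "msg_info d mu m \<le> (\<Sum>x\<in>cube d. (pmf (mu x) m / 2 ^ d) * real d)"
    by (rule sum_mono)
  also have "\<dots> = real d * ?q"
    by (simp add: msg_marginal_def sum_distrib_left sum_divide_distrib mult.commute)
  finally show ?thesis .
qed

text \<open>An infinite sum defaults to 0 when not summable; comparison with the marginal shows that
  \<open>mutual_info\<close> is a genuine sum.\<close>

lemma has_sum_mutual_info: "(msg_info d mu has_sum mutual_info d mu) UNIV"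
proof -
  have "(\<lambda>m. real d * msg_marginal d mu m) summable_on UNIV"
    using has_sum_msg_marginal by (intro summable_on_cmult_right) (auto simp: summable_on_def)
  then have "msg_info d mu summable_on UNIV"
    by (rule summable_on_comparison_test) (rule msg_info_le msg_info_nonneg)+
  then show ?thesis
    unfolding mutual_info_def by (rule has_sum_infsum)
qed

lemma mutual_info_nonneg: "mutual_info d mu \<ge> 0"
  using has_sum_mutual_info by (rule has_sum_nonneg) (rule msg_info_nonneg)

subsection \<open>Decoding the input from a message\<close>

text \<open>The error conditional on the input and the message: \<open>b\<close> stands for
  \<open>bob m\<close>, and only \<open>y\<close> stays random.\<close>

definition row_error :: "real \<Rightarrow> nat \<Rightarrow> (bool list \<Rightarrow> bool) \<Rightarrow> bool list \<Rightarrow> real" where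
  "row_error c d b x =
     real (card {y \<in> cube d. GH c d x y \<noteq> None \<and> GH c d x y \<noteq> Some (b y)}) / 2 ^ d"

lemma row_error_nonneg: "row_error c d b x \<ge> 0"
  by (simp add: row_error_def)

text \<open>Regrouping the error by message allows a comparison with \<open>msg_info\<close> term by
  term.\<close>

lemma has_sum_gh_error:
  "((\<lambda>m. \<Sum>x\<in>cube d. pmf (mu x) m / 2 ^ d * row_error c d (bob m) x)
     has_sum gh_error c d mu bob) UNIV"
proof -
  let ?bad = "\<lambda>x y. {m. GH c d x y \<noteq> None \<and> GH c d x y \<noteq> Some (bob m y)}"
  have "((\<lambda>m. if m \<in> ?bad x y then pmf (mu x) m else 0) has_sum
      measure_pmf.prob (mu x) (?bad x y)) UNIV" for x y
    using has_sum_pmf[of "mu x" "?bad x y"]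
    by (subst has_sum_cong_neutral[where T = "?bad x y" and g = "pmf (mu x)"]) auto
  then have "((\<lambda>m. \<Sum>x\<in>cube d. \<Sum>y\<in>cube d. if m \<in> ?bad x y then pmf (mu x) m else 0) has_sum
      (\<Sum>x\<in>cube d. \<Sum>y\<in>cube d. measure_pmf.prob (mu x) (?bad x y))) UNIV"
    by (intro has_sum_sum) auto
  from has_sum_cmult_right[OF this, of "1 / 2 ^ (2 * d)"]
  have "((\<lambda>m. 1 / 2 ^ (2 * d) * (\<Sum>x\<in>cube d. \<Sum>y\<in>cube d.
      if m \<in> ?bad x y then pmf (mu x) m else 0)) has_sum gh_error c d mu bob) UNIV"
    by (simp add: gh_error_def)
  also have "(\<lambda>m. 1 / 2 ^ (2 * d) * (\<Sum>x\<in>cube d. \<Sum>y\<in>cube d.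
      if m \<in> ?bad x y then pmf (mu x) m else 0))
    = (\<lambda>m. \<Sum>x\<in>cube d. pmf (mu x) m / 2 ^ d * row_error c d (bob m) x)"
  proof
    fix m
    have "(\<Sum>y\<in>cube d. if m \<in> ?bad x y then pmf (mu x) m else 0)
        = 2 ^ d * (pmf (mu x) m * row_error c d (bob m) x)" for x
    proof -
      have "(\<Sum>y\<in>cube d. if m \<in> ?bad x y then pmf (mu x) m else 0)
        = (\<Sum>y\<in>{y \<in> cube d. m \<in> ?bad x y}. pmf (mu x) m)"
        by (rule sum.inter_filter[symmetric]) simp
      then show ?thesis by (simp add: row_error_def)
    qed
    then show "1 / 2 ^ (2 * d) * (\<Sum>x\<in>cube d. \<Sum>y\<in>cube d.
        if m \<in> ?bad x y then pmf (mu x) m else 0)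
      = (\<Sum>x\<in>cube d. pmf (mu x) m / 2 ^ d * row_error c d (bob m) x)"
      by (simp add: sum_distrib_left power_add mult_2)
  qed
  finally show ?thesis .
qed

text \<open>At a separating \<open>y\<close> either answer of Bob is wrong on one of the two
  inputs.\<close>

lemma row_error_add_ge:
  assumes "p * 2 ^ d \<le> real (card {y \<in> cube d. GH c d x y = Some True \<and> GH c d x' y = Some False})"
  shows "p \<le> row_error c d b x + row_error c d b x'"
proof -
  let ?E = "\<lambda>x. {y \<in> cube d. GH c d x y \<noteq> None \<and> GH c d x y \<noteq> Some (b y)}"
  let ?S = "{y \<in> cube d. GH c d x y = Some True \<and> GH c d x' y = Some False}"
  have "card ?S \<le> card (?E x \<union> ?E x')" by (intro card_mono) auto
  also have "\<dots> \<le> card (?E x) + card (?E x')" by (rule card_Un_le)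
  finally have "p * 2 ^ d \<le> real (card (?E x)) + real (card (?E x'))" using assms by linarith
  then show ?thesis by (simp add: row_error_def field_simps)
qed

lemma power_hamming:
  assumes "length x = d"
  shows "(\<theta>::real) ^ hamming x y = (\<Prod>i<d. if x ! i \<noteq> y ! i then \<theta> else 1)"
proof -
  have "(\<Prod>i<d. if x ! i \<noteq> y ! i then \<theta> else 1) = \<theta> ^ card ({..<d} \<inter> {i. x ! i \<noteq> y ! i})"
    by (simp add: prod.If_cases)
  also have "{..<d} \<inter> {i. x ! i \<noteq> y ! i} = {i. i < length x \<and> x ! i \<noteq> y ! i}"
    using assms by auto
  finally show ?thesis by (simp add: hamming_def)
qed

text \<open>The guess for the input, given the message, is the input \<open>x0\<close> on which Bob's row errs
  least, perturbed by independent bit flips of rate \<open>\<theta>\<close>.\<close>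

lemma msg_info_ge:
  assumes \<theta>: "0 < \<theta>" "\<theta> < 1" and \<gamma>: "\<gamma> > 0" and p: "p > 0"
    and sep: "\<And>x x'. x \<in> cube d \<Longrightarrow> x' \<in> cube d \<Longrightarrow> \<gamma> * real d \<le> real (hamming x x') \<Longrightarrow>
      p * 2 ^ d \<le> real (card {y \<in> cube d. GH c d x y = Some True \<and> GH c d x' y = Some False})"
  shows "real d * (1 + log 2 (1 - \<theta>) + \<gamma> * log 2 \<theta>) * msg_marginal d mu m
      + real d * (2 / p) * log 2 \<theta> * (\<Sum>x\<in>cube d. pmf (mu x) m / 2 ^ d * row_error c d b x)
      \<le> msg_info d mu m"
proof -
  obtain x0 where x0: "x0 \<in> cube d" and
    min: "\<And>x. x \<in> cube d \<Longrightarrow> row_error c d b x0 \<le> row_error c d b x"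
    by (metis arg_min_if_finite(1) arg_min_least finite_cube cube_nonempty)
  define f where "f i v = (if v = x0 ! i then 1 - \<theta> else \<theta>)" for i v
  define w where "w x = (\<Prod>i<d. f i (x ! i))" for x
  have w1: "(\<Sum>x\<in>cube d. w x) \<le> 1"
    unfolding w_def by (subst sum_product_weight) (auto simp: f_def)
  have wpos: "w x > 0" for x
    unfolding w_def using \<theta> by (intro prod_pos) (auto simp: f_def)
  have log\<theta>: "log 2 \<theta> < 0" using \<theta> by (simp add: log_less_zero_cancel_iff)
  have bound: "real d * (1 + log 2 (1 - \<theta>) + \<gamma> * log 2 \<theta>)
        + real d * (2 / p) * log 2 \<theta> * row_error c d b x \<le> log 2 (2 ^ d * w x)"
    if x: "x \<in> cube d" for x
  proof -
    have lx: "length x = d" using x by (simp add: cube_def)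
    \<comment> \<open>If \<open>x\<close> is far from \<open>x0\<close>, minimality gives
      \<open>p \<le> 2 * row_error c d b x\<close>, so the right side is already at least
      \<open>d\<close>. The bound is linear in the row error and can therefore be averaged.\<close>
    have H: "real (hamming x x0) \<le> real d * (\<gamma> + 2 / p * row_error c d b x)"
    proof (cases "\<gamma> * real d \<le> real (hamming x x0)")
      case True
      have "p \<le> row_error c d b x + row_error c d b x0"
        using row_error_add_ge[OF sep[OF x x0 True]] .
      then have "1 \<le> 2 / p * row_error c d b x" using min[OF x] p by (simp add: field_simps)
      then have "real d * 1 \<le> real d * (\<gamma> + 2 / p * row_error c d b x)"
        using \<gamma> by (intro mult_left_mono) auto
      then show ?thesis using hamming_le[OF lx, of x0] by simp
    next
      case False
      have "0 \<le> real d * (2 / p * row_error c d b x)"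
        using p row_error_nonneg by simp
      then show ?thesis using False by (simp add: algebra_simps)
    qed
    \<comment> \<open>Charging \<open>1 - \<theta>\<close> at every coordinate, not only at
      agreements, lowers the weight but leaves the distance in a single exponent.\<close>
    have "(1 - \<theta>) ^ d * \<theta> ^ hamming x x0
        = (\<Prod>i<d. (1 - \<theta>) * (if x ! i \<noteq> x0 ! i then \<theta> else 1))"
      by (simp add: power_hamming[OF lx] prod.distrib)
    also have "\<dots> \<le> w x"
      unfolding w_def
    proof (intro prod_mono conjI)
      fix i
      show "(1 - \<theta>) * (if x ! i \<noteq> x0 ! i then \<theta> else 1) \<le> f i (x ! i)"
        using \<theta> by (auto simp: f_def mult_left_le_one_le)
    qed (use \<theta> in auto)
    finally have "log 2 (2 ^ d * ((1 - \<theta>) ^ d * \<theta> ^ hamming x x0)) \<le> log 2 (2 ^ d * w x)"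
      using \<theta> wpos[of x] by (subst log_le_cancel_iff) auto
    moreover have "log 2 (2 ^ d * ((1 - \<theta>) ^ d * \<theta> ^ hamming x x0))
        = real d + real d * log 2 (1 - \<theta>) + real (hamming x x0) * log 2 \<theta>"
      using \<theta> by (simp add: log_mult log_nat_power)
    moreover have "real d * (\<gamma> + 2 / p * row_error c d b x) * log 2 \<theta>
        \<le> real (hamming x x0) * log 2 \<theta>"
      using H log\<theta> by (intro mult_right_mono_neg) auto
    ultimately show ?thesis by (simp add: algebra_simps)
  qed
  let ?A = "real d * (1 + log 2 (1 - \<theta>) + \<gamma> * log 2 \<theta>)" and ?B = "real d * (2 / p) * log 2 \<theta>"
  have "?A * msg_marginal d mu m + ?B * (\<Sum>x\<in>cube d. pmf (mu x) m / 2 ^ d * row_error c d b x)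
      = (\<Sum>x\<in>cube d. ?A * (pmf (mu x) m / 2 ^ d) + ?B * (pmf (mu x) m / 2 ^ d * row_error c d b x))"
    by (simp only: sum.distrib sum_distrib_left[symmetric] msg_marginal_def sum_divide_distrib)
  also have "\<dots> = (\<Sum>x\<in>cube d. (pmf (mu x) m / 2 ^ d) * (?A + ?B * row_error c d b x))"
    by (intro sum.cong refl) (simp only: distrib_left mult_ac)
  also have "\<dots> \<le> (\<Sum>x\<in>cube d. (pmf (mu x) m / 2 ^ d) * log 2 (2 ^ d * w x))"
    by (intro sum_mono mult_left_mono bound) auto
  also have "\<dots> \<le> msg_info d mu m"
    using wpos w1 by (rule msg_info_ge_guess)
  finally show ?thesis .
qed

text \<open>The bound for one message is linear in its marginal and its error, which sum over all
  messages to 1 and \<open>gh_error\<close>.\<close>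

lemma mutual_info_ge:
  assumes "0 < \<theta>" "\<theta> < 1" "\<gamma> > 0" "p > 0"
    and "\<And>x x'. x \<in> cube d \<Longrightarrow> x' \<in> cube d \<Longrightarrow> \<gamma> * real d \<le> real (hamming x x') \<Longrightarrow>
      p * 2 ^ d \<le> real (card {y \<in> cube d. GH c d x y = Some True \<and> GH c d x' y = Some False})"
  shows "real d * (1 + log 2 (1 - \<theta>) + \<gamma> * log 2 \<theta>)
      + real d * (2 / p) * log 2 \<theta> * gh_error c d mu bob \<le> mutual_info d mu"
proof -
  let ?A = "real d * (1 + log 2 (1 - \<theta>) + \<gamma> * log 2 \<theta>)" and ?B = "real d * (2 / p) * log 2 \<theta>"
  have "((\<lambda>m. ?A * msg_marginal d mu m
      + ?B * (\<Sum>x\<in>cube d. pmf (mu x) m / 2 ^ d * row_error c d (bob m) x))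
      has_sum ?A * 1 + ?B * gh_error c d mu bob) UNIV"
    by (intro has_sum_add has_sum_cmult_right has_sum_msg_marginal has_sum_gh_error)
  then have "?A * 1 + ?B * gh_error c d mu bob \<le> mutual_info d mu"
    using has_sum_mutual_info by (rule has_sum_mono) (rule msg_info_ge[OF assms])
  then show ?thesis by simp
qed

section \<open>Asymptotics of the information complexity\<close>

lemma IC_oneway_nonneg: "IC_oneway c eps d \<ge> 0"
  unfolding IC_oneway_def by (intro INF_greatest) (simp add: mutual_info_nonneg)

lemma IC_oneway_ge_eventually:
  assumes c: "c > 0" and \<eta>: "\<eta> > 0"
  obtains eps0 :: real and d0 :: nat where "eps0 > 0"
    "\<And>eps d. eps \<le> eps0 \<Longrightarrow> d \<ge> d0 \<Longrightarrow> ereal ((1 - \<eta>) * real d) \<le> IC_oneway c eps d"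
proof -
  \<comment> \<open>The loss \<open>\<eta>\<close> is split into thirds: \<open>\<theta>\<close>
    fixes the loss from \<open>log 2 (1 - \<theta>)\<close>, then \<open>\<gamma>\<close> the loss
    \<open>\<gamma> * L\<close>, and finally \<open>eps0\<close> limits the loss from Bob's
    error.\<close>
  define \<theta> where "\<theta> = 1 - 2 powr (- (\<eta> / 3))"
  have "2 powr (- (\<eta> / 3)) < (2::real) powr 0" using \<eta> by (subst powr_less_cancel_iff) auto
  then have \<theta>: "0 < \<theta>" "\<theta> < 1" by (auto simp: \<theta>_def)
  have log1: "log 2 (1 - \<theta>) = - (\<eta> / 3)" by (simp add: \<theta>_def)
  define L where "L = - log 2 \<theta>"
  have L: "L > 0" using \<theta> by (simp add: L_def log_less_zero_cancel_iff)
  define \<gamma> where "\<gamma> = \<eta> / (3 * L)"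
  have \<gamma>: "\<gamma> > 0" using \<eta> L by (simp add: \<gamma>_def)
  define t where "t = (2 * c + 4) / \<gamma>"
  define p where "p = 3 / 4 * exp (- (t * (t + 2)))"
  have p: "p > 0" by (simp add: p_def)
  define eps0 where "eps0 = \<eta> * p / (6 * L)"
  show ?thesis
  proof (rule that[of eps0 "nat \<lceil>t\<^sup>2\<rceil>"])
    show "eps0 > 0" using \<eta> p L by (simp add: eps0_def)
    fix eps :: real and d :: nat
    assume eps: "eps \<le> eps0" and "d \<ge> nat \<lceil>t\<^sup>2\<rceil>"
    then have d: "real d \<ge> t\<^sup>2" by linarith
    show "ereal ((1 - \<eta>) * real d) \<le> IC_oneway c eps d"
      unfolding IC_oneway_def
    proof (intro INF_greatest, clarify)
      fix mu bob
      assume err: "gh_error c d mu bob \<le> eps"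
      have "2 / p * L * gh_error c d mu bob \<le> 2 / p * L * eps0"
        using err eps p L by (intro mult_left_mono) auto
      also have "\<dots> = \<eta> / 3" using p L by (simp add: eps0_def)
      finally have e: "2 / p * L * gh_error c d mu bob \<le> \<eta> / 3" .
      have gL: "\<gamma> * L = \<eta> / 3" using L by (simp add: \<gamma>_def)
      have "(1 - \<eta>) * real d
          \<le> (1 - \<eta> / 3 - \<gamma> * L - 2 / p * L * gh_error c d mu bob) * real d"
        using e gL by (intro mult_right_mono) auto
      also have "\<dots> = real d * (1 + log 2 (1 - \<theta>) + \<gamma> * log 2 \<theta>)
          + real d * (2 / p) * log 2 \<theta> * gh_error c d mu bob"
        by (simp add: log1 L_def algebra_simps)
      also have "\<dots> \<le> mutual_info d mu"
        using card_separating_ge[OF c \<gamma> t_def d]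
        by (intro mutual_info_ge \<theta> \<gamma> p) (auto simp: p_def)
      finally show "ereal ((1 - \<eta>) * real d) \<le> ereal (mutual_info d (fst (mu, bob)))" by simp
    qed
  qed
qed

theorem theoremE1:
  fixes c :: real
  assumes "c > 0"
  shows "\<exists>g :: real \<Rightarrow> nat \<Rightarrow> real.
           (\<forall>eps d. ereal ((1 - g eps d) * real d) \<le> IC_oneway c eps d) \<and>
           (\<forall>(es :: nat \<Rightarrow> real) (ds :: nat \<Rightarrow> nat).
              es \<longlonglongrightarrow> 0 \<longrightarrow> filterlim ds at_top sequentially \<longrightarrow>
              (\<lambda>i. g (es i) (ds i)) \<longlonglongrightarrow> 0)"
proof -
  \<comment> \<open>Capping at \<open>d\<close> keeps \<open>g\<close> real when no protocol exists
    and the infimum is infinite. It also gives \<open>g \<ge> 0\<close> for positive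
    \<open>d\<close>, so only an upper bound on \<open>g\<close> is left for the limit.\<close>
  define J where "J eps d = real_of_ereal (min (IC_oneway c eps d) (ereal (real d)))" for eps d
  have J: "ereal (J eps d) = min (IC_oneway c eps d) (ereal (real d))" for eps d
    using IC_oneway_nonneg[of c eps d] unfolding J_def
    by (intro ereal_real') (auto simp: min_def)
  have J_le: "ereal (J eps d) \<le> IC_oneway c eps d" and J_le': "J eps d \<le> real d" for eps d
    using J[of eps d] by (metis min.cobounded1, metis min.cobounded2 ereal_less_eq(3))
  define g where "g eps d = 1 - J eps d / real d" for eps d
  \<comment> \<open>For \<open>d = 0\<close> the left side is 0 and nonnegativity of
    \<open>IC_oneway\<close> suffices.\<close>
  have "ereal ((1 - g eps d) * real d) \<le> IC_oneway c eps d" for eps d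
    using J_le[of eps d] IC_oneway_nonneg[of c eps d] by (cases "d = 0") (auto simp: g_def zero_ereal_def)
  moreover have "(\<lambda>i. g (es i) (ds i)) \<longlonglongrightarrow> 0"
    if es: "es \<longlonglongrightarrow> 0" and ds: "filterlim ds at_top sequentially" for es ds
  proof (rule LIMSEQ_I)
    fix r :: real assume r: "r > 0"
    obtain eps0 d0 where eps0: "eps0 > 0" and
      IC: "\<And>eps d. eps \<le> eps0 \<Longrightarrow> d \<ge> d0 \<Longrightarrow> ereal ((1 - r / 2) * real d) \<le> IC_oneway c eps d"
      using IC_oneway_ge_eventually[OF assms half_gt_zero[OF r]] by blast
    have "\<forall>\<^sub>F i in sequentially. es i < eps0"
      using es eps0 by (rule order_tendstoD(2))
    moreover have "\<forall>\<^sub>F i in sequentially. max 1 d0 \<le> ds i"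
      using ds by (simp only: filterlim_at_top)
    ultimately have "\<forall>\<^sub>F i in sequentially. norm (g (es i) (ds i) - 0) < r"
    proof eventually_elim
      case (elim i)
      let ?d = "real (ds i)"
      have dpos: "?d > 0" using elim by simp
      have "ereal ((1 - r / 2) * ?d) \<le> ereal (J (es i) (ds i))"
        unfolding J using IC[of "es i" "ds i"] elim r by (simp add: algebra_simps)
      then have "(1 - r / 2) * ?d \<le> J (es i) (ds i)" by simp
      then have "1 - r / 2 \<le> J (es i) (ds i) / ?d" using dpos by (simp add: field_simps)
      moreover have "J (es i) (ds i) / ?d \<le> 1" using J_le'[of "es i" "ds i"] dpos by simp
      ultimately show ?case using r by (simp add: g_def)
    qed
    then show "\<exists>no. \<forall>n\<ge>no. norm (g (es n) (ds n) - 0) < r"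
      by (simp add: eventually_sequentially)
  qed
  ultimately show ?thesis by blast
qed

end
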